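(* Let $\mathcal{Q}$ be the value function defined in the context, and let the following hold: (H1) $f:\mathbb{R}^n\times\mathbb{R}^m\to\mathbb{R}\cup\{+\infty\}$ is lower semicontinuous, proper and convex; (H2) each component $g_i:\mathbb{R}^n\times\mathbb{R}^m\to\mathbb{R}\cup\{+\infty\}$, $i=1,\ldots,p$, of $g$ is convex and lower semicontinuous; (H4) for every $x\in X$ there exists $y_x\in\mathrm{ri}(Y)$ such that $Bx+Ay_x=b$ and $g(y_x,x)<0$. Assume additionally that $f$ and $g$ are differentiable on $Y\times X$. Let $\bar x\in X$, $\varepsilon\ge0$, let $\hat y(\varepsilon)$ be an $\varepsilon$-optimal feasible solution of the primal problem defining $\mathcal{Q}(\bar x)$, and let $(\hat\lambda(\varepsilon),\hat\mu(\varepsilon))$ be an $\varepsilon$-optimal feasible solution of the corresponding dual problem $\sup_{(\lambda,\mu)\in\mathbb{R}^q\times\mathbb{R}_+^p}\theta_{\bar x}(\lambda,\mu)$. Then, setting $\eta(\varepsilon)=\ell_2(\hat y(\varepsilon),\bar x,\hat\lambda(\varepsilon),\hat\mu(\varepsilon))$, the affine function $$\mathcal{C}(x):=L_{\bar x}(\hat y(\varepsilon),\hat\lambda(\varepsilon),\hat\mu(\varepsilon))-\eta(\varepsilon)+\langle\nabla_xL_{\bar x}(\hat y(\varepsilon),\hat\lambda(\varepsilon),\hat\mu(\varepsilon)),x-\bar x\rangle$$ is a cut for $\mathcal{Q}$ at $\bar x$, and the distance $\mathcal{Q}(\bar x)-\mathcal{C}(\bar x)$ is at most $\varepsilon+\ell_2(\hat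 y(\varepsilon),\bar x,\hat\lambda(\varepsilon),\hat\mu(\varepsilon))$.
   Context: $X\subseteq\mathbb{R}^m$ and $Y\subseteq\mathbb{R}^n$ are nonempty, compact, convex; $A$ and $B$ are real $q\times n$ and $q\times m$ matrices, $b\in\mathbb{R}^q$; $g=(g_1,\ldots,g_p)$. The value function is, for $x\in X$, $$\mathcal{Q}(x)=\inf\{f(y,x):y\in Y,\ Ay+Bx=b,\ g(y,x)\le0\}.$$ The Lagrangian is $L_x(y,\lambda,\mu)=f(y,x)+\lambda^T(Bx+Ay-b)+\mu^Tg(y,x)$, the dual function is $\theta_x(\lambda,\mu)=\inf_{y\in Y}L_x(y,\lambda,\mu)$, and $$\ell_2(\hat y,\bar x,\hat\lambda,\hat\mu)=\max_{y\in Y}\langle\nabla_yL_{\bar x}(\hat y,\hat\lambda,\hat\mu),\hat y-y\rangle .$$ $\nabla_xL_{\bar x}$ is the gradient of $x\mapsto L_x(y,\lambda,\mu)$ at $x=\bar x$. A cut for $\mathcal{Q}$ is an affine function $\mathcal{C}$ with $\mathcal{Q}(x)\ge\mathcal{C}(x)$ for all $x\in X$. An $\varepsilon$-optimal feasible solution is a feasible point whose objective value is within $\varepsilon$ of the optimal value. $\mathrm{ri}$ denotes relative interior. *)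

theory Defs
  imports "HOL-Analysis.Analysis"
begin

section \<open>Functions with values in the extended reals\<close>

text \<open>Functions into \<open>\<real> \<union> {+\<infinity>}\<close> are \<^typ>\<open>ereal\<close>-valued functions that avoid \<open>-\<infinity>\<close>;
  for these, the right-hand side of the convexity inequality is never of the form \<open>\<infinity> - \<infinity>\<close>,
  and \<^typ>\<open>ereal\<close> multiplication has \<open>0 * \<infinity> = 0\<close>.\<close>

definition above_minus_infinity :: "('a \<Rightarrow> ereal) \<Rightarrow> bool" where
  "above_minus_infinity f \<longleftrightarrow> (\<forall>z. f z \<noteq> -\<infinity>)"

definition proper_fun :: "('a \<Rightarrow> ereal) \<Rightarrow> bool" where
  "proper_fun f \<longleftrightarrow> above_minus_infinity f \<and> (\<exists>z. f z \<noteq> \<infinity>)"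

definition convex_ereal :: "('a::real_vector \<Rightarrow> ereal) \<Rightarrow> bool" where
  "convex_ereal f \<longleftrightarrow>
     (\<forall>z w u v. 0 \<le> u \<and> 0 \<le> v \<and> u + v = 1 \<longrightarrow>
        f (u *\<^sub>R z + v *\<^sub>R w) \<le> ereal u * f z + ereal v * f w)"

definition lower_semicontinuous :: "('a::topological_space \<Rightarrow> ereal) \<Rightarrow> bool" where
  "lower_semicontinuous f \<longleftrightarrow> (\<forall>z. f z \<le> Liminf (at z) f)"

text \<open>Differentiability at a point requires finiteness in a neighbourhood; on that neighbourhood
  \<^const>\<open>real_of_ereal\<close> loses no information.\<close>

definition differentiable_ereal_at :: "('a::real_normed_vector \<Rightarrow> ereal) \<Rightarrow> 'a \<Rightarrow> bool" where
  "differentiable_ereal_at f z \<longleftrightarrow>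
     (\<forall>\<^sub>F w in nhds z. \<bar>f w\<bar> \<noteq> \<infinity>) \<and> (\<lambda>w. real_of_ereal (f w)) differentiable (at z)"

definition grad :: "('a::real_inner \<Rightarrow> ereal) \<Rightarrow> 'a \<Rightarrow> 'a" where
  "grad f z = (THE D. GDERIV (\<lambda>w. real_of_ereal (f w)) z :> D)"


section \<open>The primal problem and its dual\<close>

text \<open>The argument order of \<open>f\<close> and of the \<open>g i\<close> is \<open>(y, x)\<close>: decision first, parameter second.\<close>

definition feasible_set ::
  "('p \<Rightarrow> (real^'n) \<times> (real^'m) \<Rightarrow> ereal) \<Rightarrow> real^'n^'q \<Rightarrow> real^'m^'q \<Rightarrow> real^'q
    \<Rightarrow> (real^'n) set \<Rightarrow> real^'m \<Rightarrow> (real^'n) set" where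
  "feasible_set g A B b Y x = {y \<in> Y. A *v y + B *v x = b \<and> (\<forall>i. g i (y, x) \<le> 0)}"

definition value_function ::
  "((real^'n) \<times> (real^'m) \<Rightarrow> ereal) \<Rightarrow> ('p \<Rightarrow> (real^'n) \<times> (real^'m) \<Rightarrow> ereal)
    \<Rightarrow> real^'n^'q \<Rightarrow> real^'m^'q \<Rightarrow> real^'q \<Rightarrow> (real^'n) set \<Rightarrow> real^'m \<Rightarrow> ereal" where
  "value_function f g A B b Y x = (INF y \<in> feasible_set g A B b Y x. f (y, x))"

definition lagrangian ::
  "((real^'n) \<times> (real^'m) \<Rightarrow> ereal) \<Rightarrow> ('p::finite \<Rightarrow> (real^'n) \<times> (real^'m) \<Rightarrow> ereal)
    \<Rightarrow> real^'n^'q \<Rightarrow> real^'m^'q \<Rightarrow> real^'q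
    \<Rightarrow> real^'m \<Rightarrow> real^'n \<Rightarrow> real^'q \<Rightarrow> real^'p \<Rightarrow> ereal" where
  "lagrangian f g A B b x y lam \<mu> =
     f (y, x) + ereal (lam \<bullet> (B *v x + A *v y - b)) + (\<Sum>i\<in>UNIV. ereal (\<mu> $ i) * g i (y, x))"

definition dual_function ::
  "((real^'n) \<times> (real^'m) \<Rightarrow> ereal) \<Rightarrow> ('p::finite \<Rightarrow> (real^'n) \<times> (real^'m) \<Rightarrow> ereal)
    \<Rightarrow> real^'n^'q \<Rightarrow> real^'m^'q \<Rightarrow> real^'q \<Rightarrow> (real^'n) set
    \<Rightarrow> real^'m \<Rightarrow> real^'q \<Rightarrow> real^'p \<Rightarrow> ereal" where
  "dual_function f g A B b Y x lam \<mu> = (INF y \<in> Y. lagrangian f g A B b x y lam \<mu>)"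

definition dual_feasible_set :: "((real^'q) \<times> (real^'p)) set" where
  "dual_feasible_set = UNIV \<times> {\<mu>. \<forall>i. 0 \<le> \<mu> $ i}"

definition dual_value ::
  "((real^'n) \<times> (real^'m) \<Rightarrow> ereal) \<Rightarrow> ('p::finite \<Rightarrow> (real^'n) \<times> (real^'m) \<Rightarrow> ereal)
    \<Rightarrow> real^'n^'q \<Rightarrow> real^'m^'q \<Rightarrow> real^'q \<Rightarrow> (real^'n) set \<Rightarrow> real^'m \<Rightarrow> ereal" where
  "dual_value f g A B b Y x = (SUP (lam, \<mu>) \<in> dual_feasible_set. dual_function f g A B b Y x lam \<mu>)"

definition eps_optimal_primal ::
  "((real^'n) \<times> (real^'m) \<Rightarrow> ereal) \<Rightarrow> ('p \<Rightarrow> (real^'n) \<times> (real^'m) \<Rightarrow> ereal)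
    \<Rightarrow> real^'n^'q \<Rightarrow> real^'m^'q \<Rightarrow> real^'q \<Rightarrow> (real^'n) set
    \<Rightarrow> real^'m \<Rightarrow> real \<Rightarrow> real^'n \<Rightarrow> bool" where
  "eps_optimal_primal f g A B b Y x \<epsilon> y \<longleftrightarrow>
     y \<in> feasible_set g A B b Y x \<and> f (y, x) \<le> value_function f g A B b Y x + ereal \<epsilon>"

definition eps_optimal_dual ::
  "((real^'n) \<times> (real^'m) \<Rightarrow> ereal) \<Rightarrow> ('p::finite \<Rightarrow> (real^'n) \<times> (real^'m) \<Rightarrow> ereal)
    \<Rightarrow> real^'n^'q \<Rightarrow> real^'m^'q \<Rightarrow> real^'q \<Rightarrow> (real^'n) set
    \<Rightarrow> real^'m \<Rightarrow> real \<Rightarrow> real^'q \<Rightarrow> real^'p \<Rightarrow> bool" where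
  "eps_optimal_dual f g A B b Y x \<epsilon> lam \<mu> \<longleftrightarrow>
     (lam, \<mu>) \<in> dual_feasible_set \<and>
     dual_value f g A B b Y x \<le> dual_function f g A B b Y x lam \<mu> + ereal \<epsilon>"


section \<open>Cuts\<close>

definition grad_y_lagrangian ::
  "((real^'n) \<times> (real^'m) \<Rightarrow> ereal) \<Rightarrow> ('p::finite \<Rightarrow> (real^'n) \<times> (real^'m) \<Rightarrow> ereal)
    \<Rightarrow> real^'n^'q \<Rightarrow> real^'m^'q \<Rightarrow> real^'q
    \<Rightarrow> real^'m \<Rightarrow> real^'n \<Rightarrow> real^'q \<Rightarrow> real^'p \<Rightarrow> real^'n" where
  "grad_y_lagrangian f g A B b x y lam \<mu> = grad (\<lambda>y'. lagrangian f g A B b x y' lam \<mu>) y"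

definition grad_x_lagrangian ::
  "((real^'n) \<times> (real^'m) \<Rightarrow> ereal) \<Rightarrow> ('p::finite \<Rightarrow> (real^'n) \<times> (real^'m) \<Rightarrow> ereal)
    \<Rightarrow> real^'n^'q \<Rightarrow> real^'m^'q \<Rightarrow> real^'q
    \<Rightarrow> real^'m \<Rightarrow> real^'n \<Rightarrow> real^'q \<Rightarrow> real^'p \<Rightarrow> real^'m" where
  "grad_x_lagrangian f g A B b x y lam \<mu> = grad (\<lambda>x'. lagrangian f g A B b x' y lam \<mu>) x"

text \<open>The supremum is a maximum when \<open>Y\<close> is compact and nonempty, by \<open>ell2_attained\<close> below.\<close>

definition ell2 ::
  "((real^'n) \<times> (real^'m) \<Rightarrow> ereal) \<Rightarrow> ('p::finite \<Rightarrow> (real^'n) \<times> (real^'m) \<Rightarrow> ereal)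
    \<Rightarrow> real^'n^'q \<Rightarrow> real^'m^'q \<Rightarrow> real^'q \<Rightarrow> (real^'n) set
    \<Rightarrow> real^'n \<Rightarrow> real^'m \<Rightarrow> real^'q \<Rightarrow> real^'p \<Rightarrow> real" where
  "ell2 f g A B b Y y x lam \<mu> = (SUP y' \<in> Y. grad_y_lagrangian f g A B b x y lam \<mu> \<bullet> (y - y'))"

lemma ell2_attained:
  assumes "compact Y" "Y \<noteq> {}"
  shows "\<exists>y0\<in>Y. ell2 f g A B b Y y x lam \<mu> = grad_y_lagrangian f g A B b x y lam \<mu> \<bullet> (y - y0) \<and>
           (\<forall>y'\<in>Y. grad_y_lagrangian f g A B b x y lam \<mu> \<bullet> (y - y') \<le> ell2 f g A B b Y y x lam \<mu>)"
proof -
  let ?h = "\<lambda>y'. grad_y_lagrangian f g A B b x y lam \<mu> \<bullet> (y - y')"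
  have "continuous_on Y ?h" by (intro continuous_intros)
  then obtain y0 where y0: "y0 \<in> Y" "\<forall>y'\<in>Y. ?h y' \<le> ?h y0"
    using continuous_attains_sup[OF assms] by blast
  then have "Sup (?h ` Y) = ?h y0" by (intro cSup_eq_maximum) auto
  with y0 show ?thesis unfolding ell2_def by metis
qed

definition affine_fun :: "('a::real_vector \<Rightarrow> real) \<Rightarrow> bool" where
  "affine_fun C \<longleftrightarrow> linear (\<lambda>x. C x - C 0)"

definition is_cut :: "('a::real_vector) set \<Rightarrow> ('a \<Rightarrow> ereal) \<Rightarrow> ('a \<Rightarrow> real) \<Rightarrow> bool" where
  "is_cut X Q C \<longleftrightarrow> affine_fun C \<and> (\<forall>x\<in>X. Q x \<ge> ereal (C x))"

end

theory Submission
  imports Defs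
begin

text \<open>
  Write \<open>L(y, x)\<close> for the Lagrangian with the multipliers fixed at the given dual point. Since
  these satisfy \<open>\<mu> \<ge> 0\<close>, \<open>L\<close> is convex jointly in \<open>(y, x)\<close> on \<open>Y \<times> X\<close>, and it minorises \<open>f\<close> at
  every point that is feasible for its parameter. The joint tangent plane of \<open>L\<close> at the reference
  point therefore lies below \<open>f(y, x)\<close> for every \<open>x \<in> X\<close> and every \<open>y\<close> feasible for \<open>x\<close>. Its slope
  in \<open>y\<close> still depends on \<open>y\<close>, and that contribution is at least \<open>- \<ell>\<^sub>2\<close> by the definition of
  \<open>\<ell>\<^sub>2\<close> as a maximum over \<open>Y\<close>; what remains is the affine function \<open>C\<close>. Taking the infimum over
  \<open>y\<close> shows that \<open>C\<close> is a cut. The ingredients are \<open>convex_on_lagrangian\<close>,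
  \<open>convex_on_above_tangent\<close> and \<open>lagrangian_le_objective\<close>.

  For the distance at the reference parameter, \<open>C\<close> is smaller than \<open>L\<close> at the reference point by
  exactly \<open>\<ell>\<^sub>2\<close>, and \<open>L\<close> there is at least the dual function, hence at least the dual value minus
  \<open>\<epsilon>\<close>. So the bound amounts to the absence of a duality gap,
  \<open>value_function_le_dual_value\<close>. This is where the Slater condition enters, through the
  existence of Lagrange multipliers (\<open>Lagrange_multipliers\<close>), proved by separating the
  origin from the convex set of attainable values of objective and constraints.
\<close>

section \<open>Tangents and gradients\<close>

text \<open>
  The difference quotient of \<open>h\<close> along the segment from \<open>z\<close> to \<open>w\<close> is at most \<open>h w - h z\<close> by
  convexity, and its limit is the directional derivative. Only one-sided quotients inside the
  segment occur, so \<open>z\<close> may lie on the boundary of \<open>S\<close>.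
\<close>

lemma convex_on_above_tangent:
  fixes h :: "'a::real_normed_vector \<Rightarrow> real"
  assumes conv: "convex_on S h" and z: "z \<in> S" and w: "w \<in> S"
    and der: "(h has_derivative h') (at z)"
  shows "h z + h' (w - z) \<le> h w"
proof -
  have lin: "linear h'"
    using der by (rule has_derivative_linear)
  have slope: "(\<lambda>t. h' (t *\<^sub>R (w - z))) = (*) (h' (w - z))"
    by (simp add: fun_eq_iff linear_cmul[OF lin])
  have "((\<lambda>t::real. z + t *\<^sub>R (w - z)) has_derivative (\<lambda>t. t *\<^sub>R (w - z))) (at 0)"
    by (auto intro!: derivative_eq_intros)
  then have "((\<lambda>t::real. h (z + t *\<^sub>R (w - z))) has_derivative (\<lambda>t. h' (t *\<^sub>R (w - z)))) (at 0)"
    by (rule has_derivative_compose) (simp add: der)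
  then have "((\<lambda>t::real. h (z + t *\<^sub>R (w - z))) has_real_derivative h' (w - z)) (at 0)"
    by (simp add: has_field_derivative_def slope)
  then have "((\<lambda>t. (h (z + t *\<^sub>R (w - z)) - h z) / t) \<longlongrightarrow> h' (w - z)) (at 0)"
    by (simp add: DERIV_def)
  then have lim: "((\<lambda>t. (h (z + t *\<^sub>R (w - z)) - h z) / t) \<longlongrightarrow> h' (w - z)) (at_right 0)"
    by (rule tendsto_mono[OF at_le, rotated]) simp
  have "\<forall>\<^sub>F t::real in at_right 0. 0 < t \<and> t < 1"
    using eventually_at_right_real[of "0::real" 1] by simp
  then have "\<forall>\<^sub>F t in at_right 0. (h (z + t *\<^sub>R (w - z)) - h z) / t \<le> h w - h z"
  proof eventually_elim
    fix t :: real assume t: "0 < t \<and> t < 1"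
    have "z + t *\<^sub>R (w - z) = (1 - t) *\<^sub>R z + t *\<^sub>R w"
      by (simp add: algebra_simps)
    then have "h (z + t *\<^sub>R (w - z)) \<le> (1 - t) * h z + t * h w"
      using convex_onD[OF conv, of t z w] z w t by simp
    then show "(h (z + t *\<^sub>R (w - z)) - h z) / t \<le> h w - h z"
      using t by (simp add: field_simps)
  qed
  from tendsto_upperbound[OF lim this] show ?thesis by simp
qed

text \<open>
  By the Riesz representation of \<open>F'\<close>, a gradient exists and is unique, so the definite description
  in \<^const>\<open>grad\<close> denotes it.
\<close>

lemma inner_grad:
  fixes F :: "'a::euclidean_space \<Rightarrow> ereal"
  assumes der: "((\<lambda>w. real_of_ereal (F w)) has_derivative F') (at z)"
  shows "grad F z \<bullet> v = F' v"
proof -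
  have lin: "linear F'"
    using der by (rule has_derivative_linear)
  have riesz: "F' h = h \<bullet> adjoint F' 1" for h
    using adjoint_works[OF lin, of h 1] by simp
  then have "GDERIV (\<lambda>w. real_of_ereal (F w)) z :> adjoint F' 1"
    using der by (simp add: gderiv_def flip: riesz)
  moreover have "D = adjoint F' 1" if "GDERIV (\<lambda>w. real_of_ereal (F w)) z :> D" for D
  proof -
    have "(\<lambda>h. h \<bullet> D) = F'"
      using has_derivative_unique that der unfolding gderiv_def by blast
    then have "\<forall>h. h \<bullet> D = h \<bullet> adjoint F' 1"
      by (metis riesz)
    then show ?thesis
      by (simp add: vector_eq_ldot)
  qed
  ultimately have "grad F z = adjoint F' 1"
    unfolding grad_def by (rule the_equality)
  then show ?thesis
    by (simp add: riesz inner_commute)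
qed

text \<open>
  The partial gradients are the two components of one joint derivative; this lets the tangent
  inequality for the jointly convex Lagrangian speak about both of them.
\<close>

lemma inner_grad_fst:
  fixes F :: "'a::euclidean_space \<times> 'b::euclidean_space \<Rightarrow> ereal"
  assumes der: "((\<lambda>w. real_of_ereal (F w)) has_derivative F') (at (y, x))"
  shows "grad (\<lambda>y'. F (y', x)) y \<bullet> v = F' (v, 0)"
proof (rule inner_grad)
  have "((\<lambda>y'. (y', x)) has_derivative (\<lambda>h. (h, 0))) (at y)"
    by (auto intro!: derivative_eq_intros)
  from has_derivative_compose[OF this der]
  show "((\<lambda>y'. real_of_ereal (F (y', x))) has_derivative (\<lambda>v. F' (v, 0))) (at y)" .
qed

lemma inner_grad_snd:
  fixes F :: "'a::euclidean_space \<times> 'b::euclidean_space \<Rightarrow> ereal"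
  assumes der: "((\<lambda>w. real_of_ereal (F w)) has_derivative F') (at (y, x))"
  shows "grad (\<lambda>x'. F (y, x')) x \<bullet> v = F' (0, v)"
proof (rule inner_grad)
  have "((\<lambda>x'. (y, x')) has_derivative (\<lambda>h. (0, h))) (at x)"
    by (auto intro!: derivative_eq_intros)
  from has_derivative_compose[OF this der]
  show "((\<lambda>x'. real_of_ereal (F (y, x'))) has_derivative (\<lambda>v. F' (0, v))) (at x)" .
qed

lemma convex_ereal_imp_convex_on_real:
  fixes f :: "'a::real_vector \<Rightarrow> ereal"
  assumes f: "convex_ereal f" and S: "convex S" and fin: "\<And>z. z \<in> S \<Longrightarrow> \<bar>f z\<bar> \<noteq> \<infinity>"
  shows "convex_on S (\<lambda>z. real_of_ereal (f z))"
  unfolding convex_on_def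
proof (intro conjI S ballI allI impI)
  fix z w and u v :: real
  assume zw: "z \<in> S" "w \<in> S" and uv: "0 \<le> u" "0 \<le> v" "u + v = 1"
  have finite_on_S: "\<exists>c. f x = ereal c" if "x \<in> S" for x
    using fin[OF that] by (cases "f x") auto
  have "u *\<^sub>R z + v *\<^sub>R w \<in> S"
    using S zw uv by (auto simp: convex_def)
  then obtain a b c where "f z = ereal a" "f w = ereal b" "f (u *\<^sub>R z + v *\<^sub>R w) = ereal c"
    using finite_on_S zw by meson
  moreover have "f (u *\<^sub>R z + v *\<^sub>R w) \<le> ereal u * f z + ereal v * f w"
    using f uv unfolding convex_ereal_def by blast
  ultimately show "real_of_ereal (f (u *\<^sub>R z + v *\<^sub>R w))
      \<le> u * real_of_ereal (f z) + v * real_of_ereal (f w)"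
    by simp
qed

section \<open>Lagrange multipliers under the Slater condition\<close>

text \<open>
  From any \<open>y\<close> in \<open>Y\<close> the segment to a relatively interior point \<open>y0\<close> can be prolonged within
  \<open>Y\<close>. If \<open>l y > l y0\<close>, the functional would drop below its minimum on the prolongation.
\<close>

lemma linear_functional_constant_of_rel_interior_min:
  fixes l :: "'a::euclidean_space \<Rightarrow> real"
  assumes "linear l" "convex Y" "y0 \<in> rel_interior Y"
    and min: "\<And>y. y \<in> Y \<Longrightarrow> l y0 \<le> l y" and y: "y \<in> Y"
  shows "l y = l y0"
proof -
  obtain e where e: "e > 1" "(1 - e) *\<^sub>R y + e *\<^sub>R y0 \<in> Y"
    using convex_rel_interior_if2[OF assms(2,3)] y hull_inc by metis
  have "l y0 \<le> (1 - e) * l y + e * l y0"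
    using min[OF e(2)] \<open>linear l\<close> by (simp add: linear_add linear_cmul)
  then have "(e - 1) * (l y - l y0) \<le> 0"
    by (simp add: algebra_simps)
  then show ?thesis
    using e(1) min[OF y] by (simp add: mult_le_0_iff)
qed

text \<open>
  The vectors that dominate \<open>(F y - v, A y - c, G y)\<close> for some \<open>y \<in> Y\<close>, strictly in the first
  component, with equality in the second and weakly in the third, form a convex set that omits
  the origin because \<open>v\<close> is a lower bound for the constrained problem. A separating functional
  \<open>(\<alpha>, lam, \<mu>)\<close> has \<open>\<alpha> \<ge> 0\<close> and \<open>\<mu> \<ge> 0\<close> since the set is closed under increasing these
  coordinates; if \<open>\<alpha> > 0\<close>, dividing by it gives the multipliers.

  The Slater point rules out \<open>\<alpha> = 0\<close>. In that case \<open>\<mu>\<close> must vanish because \<open>G y0 < 0\<close>, so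
  \<open>y \<mapsto> lam \<bullet> A y\<close> has a minimum over \<open>Y\<close> at the relatively interior point \<open>y0\<close> and is constant:
  the functional is orthogonal to the whole set. As \<open>A\<close> need not be surjective, a nonzero \<open>lam\<close> of
  this kind can exist, which is why the functional is chosen in the span of the set, where
  orthogonality to the set forces it to be zero.
\<close>

lemma Lagrange_multipliers:
  fixes F :: "'a::euclidean_space \<Rightarrow> real" and G :: "'p::finite \<Rightarrow> 'a \<Rightarrow> real"
    and A :: "'a \<Rightarrow> 'b::euclidean_space"
  assumes F: "convex_on Y F" and G: "\<And>i. convex_on Y (G i)" and A: "linear A"
    and slater: "y0 \<in> rel_interior Y" "A y0 = c" "\<And>i. G i y0 < 0"
    and lower: "\<And>y. y \<in> Y \<Longrightarrow> A y = c \<Longrightarrow> (\<And>i. G i y \<le> 0) \<Longrightarrow> v \<le> F y"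
  obtains lam :: 'b and \<mu> :: "real^'p" where "\<And>i. 0 \<le> \<mu> $ i"
    "\<And>y. y \<in> Y \<Longrightarrow> v \<le> F y + lam \<bullet> (A y - c) + (\<Sum>i\<in>UNIV. \<mu> $ i * G i y)"
proof -
  have Y: "convex Y"
    using F by (rule convex_on_imp_convex)
  have y0: "y0 \<in> Y"
    using slater(1) rel_interior_subset by blast
  define S :: "(real \<times> 'b \<times> (real^'p)) set" where
    "S = {(r, s, w). \<exists>y\<in>Y. F y < v + r \<and> s = A y - c \<and> (\<forall>i. G i y \<le> w $ i)}"
  have S_memI: "(r, A y - c, w) \<in> S" if "y \<in> Y" "F y < v + r" "\<And>i. G i y \<le> w $ i" for r y w
    using that unfolding S_def by blast
  have "convex S"
    unfolding convex_def
  proof (intro ballI allI impI)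
    fix p p' and t u :: real
    assume pp: "p \<in> S" "p' \<in> S" and tu: "0 \<le> t" "0 \<le> u" "t + u = 1"
    obtain r s w where p: "p = (r, s, w)" by (cases p)
    obtain r' s' w' where p': "p' = (r', s', w')" by (cases p')
    from pp p p' obtain y y' where
      y: "y \<in> Y" "F y < v + r" "s = A y - c" "\<And>i. G i y \<le> w $ i" and
      y': "y' \<in> Y" "F y' < v + r'" "s' = A y' - c" "\<And>i. G i y' \<le> w' $ i"
      unfolding S_def by auto
    let ?y = "t *\<^sub>R y + u *\<^sub>R y'"
    have mem: "?y \<in> Y"
      using Y y(1) y'(1) tu by (auto simp: convex_def)
    have "F ?y \<le> t * F y + u * F y'"
      using F y(1) y'(1) tu by (simp add: convex_on_def)
    also have "\<dots> < t * (v + r) + u * (v + r')"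
    proof (cases "t = 0")
      case True
      then show ?thesis using tu y'(2) by simp
    next
      case False
      then have "t * F y < t * (v + r)" using tu y(2) by simp
      moreover have "u * F y' \<le> u * (v + r')" using tu y'(2) by (simp add: mult_left_mono)
      ultimately show ?thesis by linarith
    qed
    also have "\<dots> = (t + u) * v + (t * r + u * r')"
      by (simp add: algebra_simps)
    finally have 1: "F ?y < v + (t * r + u * r')"
      using tu by simp
    have "t *\<^sub>R c + u *\<^sub>R c = c"
      using tu by (simp flip: scaleR_add_left)
    moreover have "A ?y = t *\<^sub>R A y + u *\<^sub>R A y'"
      using A by (simp add: linear_add linear_cmul)
    moreover have "t *\<^sub>R s + u *\<^sub>R s' = t *\<^sub>R A y + u *\<^sub>R A y' - (t *\<^sub>R c + u *\<^sub>R c)"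
      by (simp add: y(3) y'(3) scaleR_diff_right)
    ultimately have 2: "A ?y - c = t *\<^sub>R s + u *\<^sub>R s'"
      by simp
    have 3: "G i ?y \<le> (t *\<^sub>R w + u *\<^sub>R w') $ i" for i
    proof -
      have "G i ?y \<le> t * G i y + u * G i y'"
        using G[of i] y(1) y'(1) tu by (simp add: convex_on_def)
      also have "\<dots> \<le> t * w $ i + u * w' $ i"
        using tu y(4) y'(4) by (intro add_mono mult_left_mono) auto
      finally show ?thesis by simp
    qed
    show "t *\<^sub>R p + u *\<^sub>R p' \<in> S"
      using S_memI[OF mem 1 3] 2 p p' by simp
  qed
  moreover have "S \<noteq> {}"
    using S_memI[OF y0, of "F y0 - v + 1" 0] slater(3) by (force intro: less_imp_le)
  moreover have "0 \<notin> S"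
  proof
    assume "0 \<in> S"
    then obtain y where "y \<in> Y" "F y < v" "A y = c" "\<And>i. G i y \<le> 0"
      unfolding S_def zero_prod_def by auto
    then show False using lower[of y] by simp
  qed
  ultimately obtain a where a: "a \<in> span S" "a \<noteq> 0" "\<And>p. p \<in> S \<Longrightarrow> 0 \<le> a \<bullet> p"
    by (rule separating_hyperplane_set_0_inspan) blast
  obtain \<alpha> lam \<mu> where a_eq: "a = (\<alpha>, lam, \<mu>)" by (cases a)
  have sep: "0 \<le> \<alpha> * r + lam \<bullet> (A y - c) + \<mu> \<bullet> w"
    if "y \<in> Y" "F y < v + r" "\<And>i. G i y \<le> w $ i" for r y w
    using a(3)[OF S_memI[OF that]] a_eq by simp
  let ?G = "\<lambda>y. \<chi> i. G i y"
  \<comment> \<open>A negative \<open>\<alpha>\<close> is refuted by a large first coordinate, which makes the value negative.\<close>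
  have \<alpha>: "\<alpha> \<ge> 0"
  proof (rule ccontr)
    assume "\<not> \<alpha> \<ge> 0"
    let ?r = "\<bar>F y0 - v\<bar> + 1 + \<bar>\<mu> \<bullet> ?G y0\<bar> / (- \<alpha>)"
    have "0 \<le> \<bar>\<mu> \<bullet> ?G y0\<bar> / (- \<alpha>)"
      using \<open>\<not> \<alpha> \<ge> 0\<close> by (intro divide_nonneg_pos) auto
    then have "0 \<le> \<alpha> * ?r + \<mu> \<bullet> ?G y0"
      using sep[OF y0, of ?r "?G y0"] slater(2) by simp
    moreover have "\<alpha> * ?r = \<alpha> * (\<bar>F y0 - v\<bar> + 1) - \<bar>\<mu> \<bullet> ?G y0\<bar>"
      using \<open>\<not> \<alpha> \<ge> 0\<close> by (simp add: field_simps)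
    moreover have "\<alpha> * (\<bar>F y0 - v\<bar> + 1) < 0"
      using \<open>\<not> \<alpha> \<ge> 0\<close> by (intro mult_neg_pos) auto
    ultimately show False by linarith
  qed
  \<comment> \<open>Likewise a negative \<open>\<mu> $ i\<close>, by increasing the \<open>i\<close>-th constraint coordinate by \<open>?k\<close>.\<close>
  have \<mu>: "\<mu> $ i \<ge> 0" for i
  proof (rule ccontr)
    assume neg: "\<not> \<mu> $ i \<ge> 0"
    let ?r = "F y0 - v + 1"
    let ?k = "(\<bar>\<alpha> * ?r + \<mu> \<bullet> ?G y0\<bar> + 1) / (- \<mu> $ i)"
    have k: "?k \<ge> 0" using neg by (intro divide_nonneg_pos) auto
    have "0 \<le> \<alpha> * ?r + \<mu> \<bullet> (?G y0 + axis i ?k)"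
      using sep[OF y0, of ?r "?G y0 + axis i ?k"] slater(2) k by (simp add: axis_def)
    also have "\<dots> = \<alpha> * ?r + \<mu> \<bullet> ?G y0 + \<mu> $ i * ?k"
      by (simp add: inner_add_right inner_axis)
    also have "\<mu> $ i * ?k = - (\<bar>\<alpha> * ?r + \<mu> \<bullet> ?G y0\<bar> + 1)"
      using neg by (simp add: field_simps)
    finally show False by linarith
  qed
  \<comment> \<open>The strict inequality in the first coordinate disappears in the limit; the slack \<open>?d\<close> is
    chosen so that \<open>\<alpha> * ?d \<le> e\<close> also when \<open>\<alpha> = 0\<close>.\<close>
  have sep_closed: "0 \<le> \<alpha> * (F y - v) + lam \<bullet> (A y - c) + \<mu> \<bullet> ?G y" if y: "y \<in> Y" for y
  proof (rule field_le_epsilon)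
    fix e :: real assume e: "0 < e"
    let ?d = "e / (\<alpha> + 1)"
    have "0 \<le> \<alpha> * (F y - v + ?d) + lam \<bullet> (A y - c) + \<mu> \<bullet> ?G y"
      using sep[OF y, of "F y - v + ?d" "?G y"] e \<alpha> by simp
    moreover have "\<alpha> * ?d \<le> e"
      using e \<alpha> by (simp add: field_simps)
    ultimately show "0 \<le> \<alpha> * (F y - v) + lam \<bullet> (A y - c) + \<mu> \<bullet> ?G y + e"
      by (simp add: distrib_left)
  qed
  have "\<alpha> \<noteq> 0"
  proof
    assume \<alpha>0: "\<alpha> = 0"
    have "\<mu> $ i = 0" for i
    proof -
      have nonpos: "\<mu> $ j * G j y0 \<le> 0" for j
        using \<mu>[of j] slater(3)[of j] by (simp add: mult_le_0_iff)
      have "0 \<le> (\<Sum>j\<in>UNIV. \<mu> $ j * G j y0)"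
        using sep_closed[OF y0] \<alpha>0 slater(2) by (simp add: inner_vec_def)
      then have "(\<Sum>j\<in>UNIV. - (\<mu> $ j * G j y0)) = 0"
        using nonpos by (simp add: sum_negf order_antisym sum_nonpos)
      then have "- (\<mu> $ i * G i y0) = 0"
        using nonpos by (subst (asm) sum_nonneg_eq_0_iff) auto
      then show ?thesis using slater(3)[of i] by simp
    qed
    then have \<mu>0: "\<mu> = 0" by (simp add: vec_eq_iff)
    have "lam \<bullet> A y = lam \<bullet> A y0" if "y \<in> Y" for y
    proof (rule linear_functional_constant_of_rel_interior_min[OF _ Y slater(1) _ that])
      show "linear (\<lambda>y. lam \<bullet> A y)"
        using A by (auto simp: linear_iff inner_add_right)
      show "lam \<bullet> A y0 \<le> lam \<bullet> A y" if "y \<in> Y" for y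
        using sep_closed[OF that] \<alpha>0 \<mu>0 slater(2) by (simp add: inner_diff_right)
    qed
    then have "orthogonal a p" if "p \<in> S" for p
      using that \<alpha>0 \<mu>0 a_eq slater(2)
      by (auto simp: S_def orthogonal_def inner_diff_right)
    then have "orthogonal a a"
      by (rule orthogonal_to_span[OF a(1)])
    then show False using a(2) by (simp add: orthogonal_self)
  qed
  then have \<alpha>: "\<alpha> > 0" using \<alpha> by simp
  show thesis
  proof (rule that[of "(1 / \<alpha>) *\<^sub>R \<mu>" "(1 / \<alpha>) *\<^sub>R lam"])
    show "0 \<le> ((1 / \<alpha>) *\<^sub>R \<mu>) $ i" for i
      using \<mu>[of i] \<alpha> by simp
    fix y assume y: "y \<in> Y"
    have "0 \<le> (\<alpha> * (F y - v) + lam \<bullet> (A y - c) + \<mu> \<bullet> ?G y) / \<alpha>"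
      using sep_closed[OF y] \<alpha> by simp
    also have "\<dots> = F y - v + (lam \<bullet> (A y - c)) / \<alpha> + (\<mu> \<bullet> ?G y) / \<alpha>"
      using \<alpha> by (simp add: add_divide_distrib)
    finally show "v \<le> F y + ((1 / \<alpha>) *\<^sub>R lam) \<bullet> (A y - c) + (\<Sum>i\<in>UNIV. ((1 / \<alpha>) *\<^sub>R \<mu>) $ i * G i y)"
      by (simp add: inner_vec_def sum_divide_distrib)
  qed
qed

section \<open>The Lagrangian of a finite, differentiable problem\<close>

lemma lagrangian_eq_ereal:
  fixes g :: "'p::finite \<Rightarrow> (real^'n) \<times> (real^'m) \<Rightarrow> ereal"
  assumes "\<bar>f (y, x)\<bar> \<noteq> \<infinity>" "\<And>i. \<bar>g i (y, x)\<bar> \<noteq> \<infinity>"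
  shows "lagrangian f g A B b x y lam \<mu> =
    ereal (real_of_ereal (f (y, x)) + lam \<bullet> (B *v x + A *v y - b)
      + (\<Sum>i\<in>UNIV. \<mu> $ i * real_of_ereal (g i (y, x))))"
proof -
  have "(\<Sum>i\<in>UNIV. ereal (\<mu> $ i) * g i (y, x)) = ereal (\<Sum>i\<in>UNIV. \<mu> $ i * real_of_ereal (g i (y, x)))"
    using assms(2) by (simp add: ereal_real' flip: sum_ereal times_ereal.simps(1))
  then show ?thesis
    using assms(1) by (simp add: lagrangian_def ereal_real' flip: plus_ereal.simps(1))
qed

lemma differentiable_ereal_at_finite:
  assumes "differentiable_ereal_at f z"
  shows "\<bar>f z\<bar> \<noteq> \<infinity>"
proof -
  have "\<forall>\<^sub>F w in nhds z. \<bar>f w\<bar> \<noteq> \<infinity>"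
    using assms by (simp add: differentiable_ereal_at_def)
  then show ?thesis
    by (rule eventually_nhds_x_imp_x)
qed

text \<open>
  At infinite values \<^const>\<open>real_of_ereal\<close> does not commute with addition, so the sum rule applies
  to the real formula, which agrees with the Lagrangian on a neighbourhood where \<open>f\<close> and all
  \<open>g i\<close> are finite.
\<close>

lemma differentiable_lagrangian:
  fixes g :: "'p::finite \<Rightarrow> (real^'n) \<times> (real^'m) \<Rightarrow> ereal"
  assumes f: "differentiable_ereal_at f z" and g: "\<And>i. differentiable_ereal_at (g i) z"
  shows "(\<lambda>w. real_of_ereal (lagrangian f g A B b (snd w) (fst w) lam \<mu>)) differentiable (at z)"
proof -
  let ?h = "\<lambda>w. real_of_ereal (f w) + lam \<bullet> (B *v snd w + A *v fst w - b)
      + (\<Sum>i\<in>UNIV. \<mu> $ i * real_of_ereal (g i w))"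
  have f_ev: "\<forall>\<^sub>F w in nhds z. \<bar>f w\<bar> \<noteq> \<infinity>" and f_diff: "(\<lambda>w. real_of_ereal (f w)) differentiable (at z)"
    using f by (simp_all add: differentiable_ereal_at_def)
  have g_ev: "\<forall>\<^sub>F w in nhds z. \<bar>g i w\<bar> \<noteq> \<infinity>" and g_diff: "(\<lambda>w. real_of_ereal (g i w)) differentiable (at z)" for i
    using g[of i] by (simp_all add: differentiable_ereal_at_def)
  have "\<forall>\<^sub>F w in nhds z. \<bar>f w\<bar> \<noteq> \<infinity> \<and> (\<forall>i. \<bar>g i w\<bar> \<noteq> \<infinity>)"
    by (intro eventually_conj eventually_all_finite f_ev g_ev)
  then have ev: "\<forall>\<^sub>F w in nhds z. ?h w = real_of_ereal (lagrangian f g A B b (snd w) (fst w) lam \<mu>)"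
    by eventually_elim (simp add: lagrangian_eq_ereal)
  have lin: "(\<lambda>w. M *v fst w) differentiable at z" "(\<lambda>w. N *v snd w) differentiable at z"
    for M :: "real^'n^'q" and N :: "real^'m^'q"
    by (intro linear_imp_differentiable linearI;
        simp add: matrix_vector_right_distrib matrix_vector_mult_scaleR)+
  have "?h differentiable (at z)"
    by (intro differentiable_add differentiable_sum differentiable_inner differentiable_diff
        differentiable_mult differentiable_const lin f_diff g_diff ballI finite)
  then obtain h' where h': "(?h has_derivative h') (at z)"
    by (auto simp: differentiable_def)
  have "\<forall>\<^sub>F w in at z. ?h w = real_of_ereal (lagrangian f g A B b (snd w) (fst w) lam \<mu>)"
    using ev unfolding eventually_at_filter by (rule eventually_mono) simp
  from has_derivative_transform_eventually[OF h' this eventually_nhds_x_imp_x[OF ev]]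
  have "((\<lambda>w. real_of_ereal (lagrangian f g A B b (snd w) (fst w) lam \<mu>)) has_derivative h') (at z)"
    by simp
  then show ?thesis
    by (auto simp: differentiable_def)
qed

lemma convex_on_lagrangian:
  fixes g :: "'p::finite \<Rightarrow> (real^'n) \<times> (real^'m) \<Rightarrow> ereal"
  assumes S: "convex S" and f: "convex_ereal f" "\<And>z. z \<in> S \<Longrightarrow> \<bar>f z\<bar> \<noteq> \<infinity>"
    and g: "\<And>i. convex_ereal (g i)" "\<And>i z. z \<in> S \<Longrightarrow> \<bar>g i z\<bar> \<noteq> \<infinity>"
    and \<mu>: "\<And>i. 0 \<le> \<mu> $ i"
  shows "convex_on S (\<lambda>w. real_of_ereal (lagrangian f g A B b (snd w) (fst w) lam \<mu>))"
proof -
  have aff: "convex_on S (\<lambda>w. lam \<bullet> (B *v snd w + A *v fst w - b))"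
    unfolding convex_on_def
  proof (intro conjI S ballI allI impI eq_refl)
    fix z w and u v :: real
    assume "u + v = 1"
    then have "u * (lam \<bullet> b) + v * (lam \<bullet> b) = lam \<bullet> b" by (simp flip: distrib_right)
    then show "lam \<bullet> (B *v snd (u *\<^sub>R z + v *\<^sub>R w) + A *v fst (u *\<^sub>R z + v *\<^sub>R w) - b)
      = u * (lam \<bullet> (B *v snd z + A *v fst z - b)) + v * (lam \<bullet> (B *v snd w + A *v fst w - b))"
      by (simp add: matrix_vector_right_distrib inner_add_right inner_diff_right
          matrix_vector_mult_scaleR algebra_simps)
  qed
  have "convex_on S (\<lambda>w. real_of_ereal (f w) + lam \<bullet> (B *v snd w + A *v fst w - b)
      + (\<Sum>i\<in>I. \<mu> $ i * real_of_ereal (g i w)))" if "finite I" for I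
    using that
  proof induction
    case empty
    then show ?case
      using convex_on_add[OF convex_ereal_imp_convex_on_real[OF f(1) S f(2)] aff] by simp
  next
    case (insert i I)
    have "convex_on S (\<lambda>w. \<mu> $ i * real_of_ereal (g i w))"
      using \<mu> g S by (intro convex_on_cmul convex_ereal_imp_convex_on_real) auto
    from convex_on_add[OF insert.IH this] insert.hyps show ?case
      by (simp add: algebra_simps)
  qed
  from this[of UNIV] have conv: "convex_on S (\<lambda>w. real_of_ereal (f w)
      + lam \<bullet> (B *v snd w + A *v fst w - b) + (\<Sum>i\<in>UNIV. \<mu> $ i * real_of_ereal (g i w)))"
    by simp
  have eq: "real_of_ereal (lagrangian f g A B b (snd w) (fst w) lam \<mu>)
      = real_of_ereal (f w) + lam \<bullet> (B *v snd w + A *v fst w - b)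
        + (\<Sum>i\<in>UNIV. \<mu> $ i * real_of_ereal (g i w))" if "w \<in> S" for w
    using f(2)[OF that] g(2)[OF that] by (simp add: lagrangian_eq_ereal)
  show ?thesis
    unfolding convex_on_def
  proof (intro conjI S ballI allI impI)
    fix z w and u v :: real
    assume zw: "z \<in> S" "w \<in> S" and uv: "0 \<le> u" "0 \<le> v" "u + v = 1"
    have "u *\<^sub>R z + v *\<^sub>R w \<in> S"
      using S zw uv by (simp add: convex_def)
    with zw uv conv show "real_of_ereal (lagrangian f g A B b (snd (u *\<^sub>R z + v *\<^sub>R w))
        (fst (u *\<^sub>R z + v *\<^sub>R w)) lam \<mu>)
      \<le> u * real_of_ereal (lagrangian f g A B b (snd z) (fst z) lam \<mu>)
        + v * real_of_ereal (lagrangian f g A B b (snd w) (fst w) lam \<mu>)"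
      unfolding convex_on_def by (simp only: eq)
  qed
qed

section \<open>Duality\<close>

lemma lagrangian_le_objective:
  assumes "y \<in> feasible_set g A B b Y x" and "\<And>i. 0 \<le> \<mu> $ i"
  shows "lagrangian f g A B b x y lam \<mu> \<le> f (y, x)"
proof -
  have "(\<Sum>i\<in>UNIV. ereal (\<mu> $ i) * g i (y, x)) \<le> 0"
    using assms by (intro sum_nonpos) (auto simp: feasible_set_def ereal_mult_le_0_iff)
  moreover have "B *v x + A *v y - b = 0"
    using assms(1) by (simp add: feasible_set_def add.commute)
  ultimately show ?thesis
    using add_left_mono[of _ 0 "f (y, x)"] by (simp add: lagrangian_def)
qed

text \<open>
  When the optimal value is a real number \<open>v\<close>, multipliers exist whose Lagrangian is at least
  \<open>v\<close> on all of \<open>Y\<close>, so the dual function reaches \<open>v\<close>. The Slater point is feasible and \<open>f\<close> is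
  finite there, hence the value is never \<open>\<infinity>\<close>; for \<open>-\<infinity>\<close> there is nothing to show.
\<close>

lemma value_function_le_dual_value:
  fixes g :: "'p::finite \<Rightarrow> (real^'n) \<times> (real^'m) \<Rightarrow> ereal"
    and A :: "real^'n^'q" and B :: "real^'m^'q"
  assumes Y: "convex Y"
    and f: "convex_ereal f" "\<And>y. y \<in> Y \<Longrightarrow> \<bar>f (y, x)\<bar> \<noteq> \<infinity>"
    and g: "\<And>i. convex_ereal (g i)" "\<And>i y. y \<in> Y \<Longrightarrow> \<bar>g i (y, x)\<bar> \<noteq> \<infinity>"
    and slater: "y0 \<in> rel_interior Y" "B *v x + A *v y0 = b" "\<And>i. g i (y0, x) < 0"
  shows "value_function f g A B b Y x \<le> dual_value f g A B b Y x"
proof (cases "value_function f g A B b Y x")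
  case (real v)
  have y0: "y0 \<in> Y"
    using slater(1) rel_interior_subset by blast
  have conv: "convex_on Y (\<lambda>y. real_of_ereal (h (y, x)))"
    if h: "convex_ereal h" "\<And>y. y \<in> Y \<Longrightarrow> \<bar>h (y, x)\<bar> \<noteq> \<infinity>" for h :: "(real^'n) \<times> (real^'m) \<Rightarrow> ereal"
  proof (rule convex_ereal_imp_convex_on_real[OF _ Y h(2)])
    show "convex_ereal (\<lambda>y. h (y, x))"
      unfolding convex_ereal_def
    proof (intro allI impI)
      fix z w and u v :: real
      assume uv: "0 \<le> u \<and> 0 \<le> v \<and> u + v = 1"
      then have "h (u *\<^sub>R (z, x) + v *\<^sub>R (w, x)) \<le> ereal u * h (z, x) + ereal v * h (w, x)"
        using h(1) unfolding convex_ereal_def by blast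
      moreover have "u *\<^sub>R (z, x) + v *\<^sub>R (w, x) = (u *\<^sub>R z + v *\<^sub>R w, x)"
        using uv by (simp flip: scaleR_add_left)
      ultimately show "h (u *\<^sub>R z + v *\<^sub>R w, x) \<le> ereal u * h (z, x) + ereal v * h (w, x)"
        by simp
    qed
  qed
  have conv_f: "convex_on Y (\<lambda>y. real_of_ereal (f (y, x)))"
    using f by (rule conv)
  have conv_g: "convex_on Y (\<lambda>y. real_of_ereal (g i (y, x)))" for i
    using g by (rule conv)
  have lower: "v \<le> real_of_ereal (f (y, x))"
    if y: "y \<in> Y" "A *v y = b - B *v x" "\<And>i. real_of_ereal (g i (y, x)) \<le> 0" for y
  proof -
    have "g i (y, x) \<le> 0" for i
      using y(3)[of i] g(2)[OF y(1), of i] by (cases "g i (y, x)") auto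
    then have "y \<in> feasible_set g A B b Y x"
      using y(1,2) by (simp add: feasible_set_def)
    then have "value_function f g A B b Y x \<le> f (y, x)"
      unfolding value_function_def by (rule INF_lower)
    then show ?thesis
      using real f(2)[OF y(1)] by (cases "f (y, x)") auto
  qed
  have neg: "real_of_ereal (g i (y0, x)) < 0" for i
    using slater(3)[of i] g(2)[OF y0, of i] by (cases "g i (y0, x)") auto
  have eq: "A *v y0 = b - B *v x"
    using slater(2) by (simp add: algebra_simps)
  obtain lam :: "real^'q" and \<mu> :: "real^'p" where \<mu>: "\<And>i. 0 \<le> \<mu> $ i"
    and bd: "\<And>y. y \<in> Y \<Longrightarrow> v \<le> real_of_ereal (f (y, x)) + lam \<bullet> (A *v y - (b - B *v x))
      + (\<Sum>i\<in>UNIV. \<mu> $ i * real_of_ereal (g i (y, x)))"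
  proof (rule Lagrange_multipliers[OF conv_f conv_g matrix_vector_mul_linear slater(1) eq neg])
    fix y
    assume "y \<in> Y" "A *v y = b - B *v x" "\<And>i. real_of_ereal (g i (y, x)) \<le> 0"
    then show "v \<le> real_of_ereal (f (y, x))" by (rule lower)
  qed blast
  have "ereal v \<le> lagrangian f g A B b x y lam \<mu>" if y: "y \<in> Y" for y
    using bd[OF y] lagrangian_eq_ereal[of f y x g A B b lam \<mu>] f(2)[OF y] g(2)[OF y]
    by (simp add: algebra_simps)
  then have "ereal v \<le> dual_function f g A B b Y x lam \<mu>"
    unfolding dual_function_def by (intro INF_greatest)
  also have "\<dots> \<le> dual_value f g A B b Y x"
    unfolding dual_value_def using \<mu>
    by (intro SUP_upper2[of "(lam, \<mu>)"]) (auto simp: dual_feasible_set_def)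
  finally show ?thesis
    using real by simp
next
  case PInf
  have y0: "y0 \<in> Y"
    using slater(1) rel_interior_subset by blast
  have "y0 \<in> feasible_set g A B b Y x"
    using y0 slater(2) order_less_imp_le[OF slater(3)] by (simp add: feasible_set_def add.commute)
  then have "value_function f g A B b Y x \<le> f (y0, x)"
    unfolding value_function_def by (rule INF_lower)
  then show ?thesis
    using PInf f(2)[OF y0] by auto
qed simp

section \<open>Inexact cuts\<close>

theorem proposition2p7:
  fixes f :: "(real^'n) \<times> (real^'m) \<Rightarrow> ereal"
    and g :: "'p::finite \<Rightarrow> (real^'n) \<times> (real^'m) \<Rightarrow> ereal"
    and A :: "real^'n^'q" and B :: "real^'m^'q" and b :: "real^'q"
    and X :: "(real^'m) set" and Y :: "(real^'n) set"
    and xbar :: "real^'m" and yhat :: "real^'n"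
    and lamhat :: "real^'q" and muhat :: "real^'p" and \<epsilon> :: real
  assumes X: "X \<noteq> {}" "compact X" "convex X"
    and Y: "Y \<noteq> {}" "compact Y" "convex Y"
    and H1: "lower_semicontinuous f" "proper_fun f" "convex_ereal f"
    and H2: "\<And>i. above_minus_infinity (g i)" "\<And>i. convex_ereal (g i)"
            "\<And>i. lower_semicontinuous (g i)"
    and H4: "\<And>x. x \<in> X \<Longrightarrow>
               \<exists>y \<in> rel_interior Y. B *v x + A *v y = b \<and> (\<forall>i. g i (y, x) < 0)"
    and diff_f: "\<And>z. z \<in> Y \<times> X \<Longrightarrow> differentiable_ereal_at f z"
    and diff_g: "\<And>i z. z \<in> Y \<times> X \<Longrightarrow> differentiable_ereal_at (g i) z"
    and xbar: "xbar \<in> X"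
    and eps: "\<epsilon> \<ge> 0"
    and yhat: "eps_optimal_primal f g A B b Y xbar \<epsilon> yhat"
    and dual: "eps_optimal_dual f g A B b Y xbar \<epsilon> lamhat muhat"
  shows "let Q = value_function f g A B b Y;
             \<eta> = ell2 f g A B b Y yhat xbar lamhat muhat;
             C = (\<lambda>x. real_of_ereal (lagrangian f g A B b xbar yhat lamhat muhat) - \<eta>
                   + grad_x_lagrangian f g A B b xbar yhat lamhat muhat \<bullet> (x - xbar))
         in is_cut X Q C \<and>
            Q xbar - ereal (C xbar) \<le> ereal (\<epsilon> + ell2 f g A B b Y yhat xbar lamhat muhat)"
proof -
  let ?L = "\<lambda>w. lagrangian f g A B b (snd w) (fst w) lamhat muhat"
  let ?R = "\<lambda>w. real_of_ereal (?L w)"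
  let ?gx = "grad_x_lagrangian f g A B b xbar yhat lamhat muhat"
  let ?gy = "grad_y_lagrangian f g A B b xbar yhat lamhat muhat"
  let ?ell = "ell2 f g A B b Y yhat xbar lamhat muhat"
  define C where "C x = ?R (yhat, xbar) - ?ell + ?gx \<bullet> (x - xbar)" for x
  have f_fin: "\<bar>f z\<bar> \<noteq> \<infinity>" if "z \<in> Y \<times> X" for z
    using diff_f[OF that] by (rule differentiable_ereal_at_finite)
  have g_fin: "\<bar>g i z\<bar> \<noteq> \<infinity>" if "z \<in> Y \<times> X" for z i
    using diff_g[OF that] by (rule differentiable_ereal_at_finite)
  have yY: "yhat \<in> Y"
    using yhat by (simp add: eps_optimal_primal_def feasible_set_def)
  have mu: "0 \<le> muhat $ i" for i
    using dual by (simp add: eps_optimal_dual_def dual_feasible_set_def)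
  have L_fin: "?L (y, x) = ereal (?R (y, x))" if "y \<in> Y" "x \<in> X" for x y
    using f_fin[of "(y, x)"] g_fin[of "(y, x)"] that by (simp add: lagrangian_eq_ereal)
  have conv: "convex_on (Y \<times> X) ?R"
    by (rule convex_on_lagrangian[OF convex_Times[OF Y(3) X(3)] H1(3) f_fin H2(2) g_fin mu])
  have opt_mem: "(yhat, xbar) \<in> Y \<times> X"
    using yY xbar by simp
  have "?R differentiable (at (yhat, xbar))"
    using diff_f[OF opt_mem] diff_g[OF opt_mem] by (rule differentiable_lagrangian)
  then obtain L' where L': "(?R has_derivative L') (at (yhat, xbar))"
    unfolding differentiable_def by blast
  have gy: "?gy \<bullet> v = L' (v, 0)" for v
    using inner_grad_fst[OF L'] by (simp add: grad_y_lagrangian_def)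
  have gx: "?gx \<bullet> v = L' (0, v)" for v
    using inner_grad_snd[OF L'] by (simp add: grad_x_lagrangian_def)
  have cut: "ereal (C x) \<le> value_function f g A B b Y x" if x: "x \<in> X" for x
    unfolding value_function_def
  proof (rule INF_greatest)
    fix y assume y: "y \<in> feasible_set g A B b Y x"
    then have yY': "y \<in> Y" by (auto simp: feasible_set_def)
    \<comment> \<open>The variation of the tangent plane in \<open>y\<close> costs at most \<open>\<ell>\<^sub>2\<close>, uniformly in \<open>y \<in> Y\<close>.\<close>
    have "?gy \<bullet> (yhat - y) \<le> ?ell"
      using ell2_attained[OF Y(2,1)] yY' by blast
    then have "- ?ell \<le> ?gy \<bullet> (y - yhat)"
      by (simp add: inner_diff_right)
    moreover have "L' (y - yhat, x - xbar) = ?gy \<bullet> (y - yhat) + ?gx \<bullet> (x - xbar)"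
      using linear_add[OF has_derivative_linear[OF L'], of "(y - yhat, 0)" "(0, x - xbar)"]
      by (simp add: gx gy)
    moreover have "?R (yhat, xbar) + L' (y - yhat, x - xbar) \<le> ?R (y, x)"
      using convex_on_above_tangent[OF conv _ _ L', of "(y, x)"] yY yY' x xbar by simp
    ultimately have "C x \<le> ?R (y, x)"
      unfolding C_def by linarith
    then have "ereal (C x) \<le> ?L (y, x)"
      using L_fin[OF yY' x] by (metis ereal_less_eq(3))
    also have "\<dots> \<le> f (y, x)"
      using lagrangian_le_objective[OF y mu] by simp
    finally show "ereal (C x) \<le> f (y, x)" .
  qed
  have "affine_fun C"
    by (auto simp: affine_fun_def C_def linear_iff inner_diff_right inner_add_right)
  then have is_cut: "is_cut X (value_function f g A B b Y) C"
    using cut by (simp add: is_cut_def)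
  obtain y0 where y0: "y0 \<in> rel_interior Y" "B *v xbar + A *v y0 = b" "\<And>i. g i (y0, xbar) < 0"
    using H4[OF xbar] by blast
  have "value_function f g A B b Y xbar \<le> dual_value f g A B b Y xbar"
    by (rule value_function_le_dual_value[OF Y(3) H1(3) f_fin H2(2) g_fin y0]) (simp_all add: xbar)
  also have "\<dots> \<le> dual_function f g A B b Y xbar lamhat muhat + ereal \<epsilon>"
    using dual by (simp add: eps_optimal_dual_def)
  also have "\<dots> \<le> ?L (yhat, xbar) + ereal \<epsilon>"
    unfolding dual_function_def using yY by (intro add_right_mono INF_lower2[of yhat]) auto
  also have "\<dots> = ereal (?R (yhat, xbar) + \<epsilon>)"
    using L_fin[OF yY xbar] by (metis plus_ereal.simps(1))
  finally have "value_function f g A B b Y xbar - ereal (C xbar) \<le> ereal (\<epsilon> + ?ell)"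
    by (cases "value_function f g A B b Y xbar") (auto simp: C_def)
  with is_cut show ?thesis
    by (simp add: Let_def C_def[abs_def])
qed

end
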